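(* For each $\theta^*\in\mathbb{R}$, let $H_{0,\theta^*}:\theta(1)\le\theta^*$, and let $(\phi_{H_{0,\theta^*}})_{\theta^*\in\mathbb{R}}$ be a collection of agnostic tests such that: (a) for every $x\in\mathcal{X}$, if $\theta_1\le\theta_2$ and $\phi_{H_{0,\theta_1}}(x)=0$, then $\phi_{H_{0,\theta_2}}(x)=0$; (b) for every $x\in\mathcal{X}$, if $\theta_1\le\theta_2$ and $\phi_{H_{0,\theta_2}}(x)=1$, then $\phi_{H_{0,\theta_1}}(x)=1$; (c) for every $\theta^*\in\mathbb{R}$ and every $\theta\in\Theta$ with $\theta(1)=\theta^*$, $\mathbb{P}_\theta\left(\phi_{H_{0,\theta^*}}=\tfrac12\right)\ge1-2\alpha$. Let $R(X)$ be a region estimator with confidence $1-2\alpha$ for $\theta$ such that $\phi_{H_{0,\theta^*}}$ is based on $R$ for every $\theta^*\in\mathbb{R}$. Consider the collection of agnostic tests $(\phi_{H_{0,\Theta_0},R})_{\Theta_0\subset\mathbb{R}}$, where $H_{0,\Theta_0}:\theta(1)\in\Theta_0$. Then (i) this collection is logically coherent; (ii) each test in this collection has size $(2\alpha,2\alpha)$; (iii) this collection is an extension of the collection $(\phi_{H_{0,\theta^*}})_{\theta^*\in\mathbb{R}}$, i.e. $\phi_{H_{0,(-\infty,\theta^*]},R}=\phi_{H_{0,\theta^*}}$ for every $\theta^*\in\mathbb{R}$.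
   Context: Setting: $X$ is the data, taking values in the sample space $\mathcal{X}$; the parameter $\theta$ lies in $\Theta$, a space of real vectors, and $\theta(1)$ denotes the first coordinate of $\theta$; $\mathbb{P}_\theta$ is the distribution of $X$ when the parameter is $\theta$. In (a), (b), $\theta_1,\theta_2$ are real numbers. A hypothesis is identified with the set of $\theta\in\Theta$ satisfying it. An agnostic test is a function $\phi:\mathcal{X}\to\{0,\tfrac12,1\}$ ($0$ = accept the null hypothesis, $1$ = reject it, $\tfrac12$ = remain agnostic). A test for $H_0$ has $(\alpha,\beta)$-size if $\sup_{\theta_0\in H_0}\mathbb{P}_{\theta_0}(\phi=1)\le\alpha$ and $\sup_{\theta_1\in H_0^c}\mathbb{P}_{\theta_1}(\phi=0)\le\beta$. A region estimator is a function $R:\mathcal{X}\to\mathcal{P}(\Theta)$. It has confidence $1-\gamma$ if $\mathbb{P}_\theta(\theta\in R(X))\ge1-\gamma$ for every $\theta\in\Theta$. A test for $H_0\subseteq\Theta$ is based on $R$ if it equals $\phi_{H_0,R}$, where $\phi_{H_0,R}(x)=0$ if $R(x)\subseteq H_0$, $=1$ if $R(x)\subseteq H_0^c$, and $=\tfrac12$ otherwise. Logical coherence (logical consistency): a collection of tests $(\phi_H)_{H\in\mathcal{H}}$ is logically coherent if no logical contradictions arise between its conclusions; that is, for every $x\in\mathcal{X}$: (monotonicity) $A\subseteq B$ implies $\phi_B(x)\le\phi_A(x)$; (invertibility) $\phi_{A^c}(x)=1-\phi_A(x)$; (intersection consonance) if $\phi_{A_i}(x)=0$ for all $i$ in an index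 set $I$, then $\phi_{\cap_iA_i}(x)=0$; (union consonance) if $\phi_{A_i}(x)=1$ for all $i\in I$, then $\phi_{\cup_iA_i}(x)=1$ (all sets involved being in $\mathcal{H}$). *)

theory Defs
  imports "HOL-Probability.Probability"
begin

(* Throughout, X is the sample space as a set, Theta the parameter space, P t the distribution of
   the data under the parameter t, and complements of hypotheses are taken in Theta. *)

definition statistical_model :: "'x measure \<Rightarrow> 'p set \<Rightarrow> ('p \<Rightarrow> 'x measure) \<Rightarrow> bool" where
  "statistical_model M \<Theta> P \<longleftrightarrow> (\<forall>\<theta>\<in>\<Theta>. prob_space (P \<theta>) \<and> sets (P \<theta>) = sets M)"

definition agnostic_test :: "'x set \<Rightarrow> ('x \<Rightarrow> real) \<Rightarrow> bool" where
  "agnostic_test X \<phi> \<longleftrightarrow> (\<forall>x\<in>X. \<phi> x \<in> {0, 1/2, 1})"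

(* Rejection and acceptance events of a test for an arbitrary hypothesis need not be measurable,
   and the constant measure is 0 on non-measurable sets. Upper bounds on probabilities are
   therefore stated with the outer probability, which is the probability on measurable events
   (outer_prob_eq below). *)
definition outer_prob :: "'x measure \<Rightarrow> 'x set \<Rightarrow> real" where
  "outer_prob M A = enn2real (outer_measure_of M A)"

lemma outer_prob_eq: "A \<in> sets M \<Longrightarrow> outer_prob M A = measure M A"
  by (simp add: outer_prob_def measure_def)

(* The suprema are taken in ereal, so that the supremum over an empty hypothesis imposes no
   constraint. *)
definition has_size ::
  "'x set \<Rightarrow> 'p set \<Rightarrow> ('p \<Rightarrow> 'x measure) \<Rightarrow> 'p set \<Rightarrow> ('x \<Rightarrow> real) \<Rightarrow> real \<Rightarrow> real \<Rightarrow> bool" where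
  "has_size X \<Theta> P H \<phi> \<alpha> \<beta> \<longleftrightarrow>
     (SUP \<theta>\<in>H. ereal (outer_prob (P \<theta>) {x \<in> X. \<phi> x = 1})) \<le> ereal \<alpha> \<and>
     (SUP \<theta>\<in>\<Theta> - H. ereal (outer_prob (P \<theta>) {x \<in> X. \<phi> x = 0})) \<le> ereal \<beta>"

definition region_estimator :: "'x set \<Rightarrow> 'p set \<Rightarrow> ('x \<Rightarrow> 'p set) \<Rightarrow> bool" where
  "region_estimator X \<Theta> R \<longleftrightarrow> (\<forall>x\<in>X. R x \<subseteq> \<Theta>)"

definition has_confidence ::
  "'x set \<Rightarrow> 'p set \<Rightarrow> ('p \<Rightarrow> 'x measure) \<Rightarrow> ('x \<Rightarrow> 'p set) \<Rightarrow> real \<Rightarrow> bool" where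
  "has_confidence X \<Theta> P R c \<longleftrightarrow> (\<forall>\<theta>\<in>\<Theta>. measure (P \<theta>) {x \<in> X. \<theta> \<in> R x} \<ge> c)"

definition region_test :: "'p set \<Rightarrow> ('x \<Rightarrow> 'p set) \<Rightarrow> 'p set \<Rightarrow> 'x \<Rightarrow> real" where
  "region_test \<Theta> R H x = (if R x \<subseteq> H then 0 else if R x \<subseteq> \<Theta> - H then 1 else 1/2)"

(* All clauses of the case distinction defining the test based on R must hold. The first two
   overlap exactly when R x is empty, where they would demand both 0 and 1; see
   based_on_iff_region_test. *)
definition based_on ::
  "'x set \<Rightarrow> 'p set \<Rightarrow> ('x \<Rightarrow> 'p set) \<Rightarrow> 'p set \<Rightarrow> ('x \<Rightarrow> real) \<Rightarrow> bool" where
  "based_on X \<Theta> R H \<phi> \<longleftrightarrow> (\<forall>x\<in>X.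
     (R x \<subseteq> H \<longrightarrow> \<phi> x = 0) \<and>
     (R x \<subseteq> \<Theta> - H \<longrightarrow> \<phi> x = 1) \<and>
     (\<not> R x \<subseteq> H \<and> \<not> R x \<subseteq> \<Theta> - H \<longrightarrow> \<phi> x = 1/2))"

lemma based_on_iff_region_test:
  "based_on X \<Theta> R H \<phi> \<longleftrightarrow> (\<forall>x\<in>X. R x \<noteq> {} \<and> \<phi> x = region_test \<Theta> R H x)"
proof -
  have *: "R x = {}" if "R x \<subseteq> H" "R x \<subseteq> \<Theta> - H" for x
    using that by blast
  show ?thesis
    unfolding based_on_def region_test_def
    by (rule ball_cong) (use * in \<open>force+\<close>)
qed

(* HH is the collection of hypotheses; empty families are allowed, with intersection Theta. *)
definition logically_coherent ::
  "'x set \<Rightarrow> 'p set \<Rightarrow> 'p set set \<Rightarrow> ('p set \<Rightarrow> 'x \<Rightarrow> real) \<Rightarrow> bool" where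
  "logically_coherent X \<Theta> HH \<phi> \<longleftrightarrow> (\<forall>x\<in>X.
     (\<forall>A\<in>HH. \<forall>B\<in>HH. A \<subseteq> B \<longrightarrow> \<phi> B x \<le> \<phi> A x) \<and>
     (\<forall>A\<in>HH. \<Theta> - A \<in> HH \<longrightarrow> \<phi> (\<Theta> - A) x = 1 - \<phi> A x) \<and>
     (\<forall>AA\<subseteq>HH. \<Theta> \<inter> \<Inter>AA \<in> HH \<longrightarrow> (\<forall>A\<in>AA. \<phi> A x = 0) \<longrightarrow> \<phi> (\<Theta> \<inter> \<Inter>AA) x = 0) \<and>
     (\<forall>AA\<subseteq>HH. \<Union>AA \<in> HH \<longrightarrow> (\<forall>A\<in>AA. \<phi> A x = 1) \<longrightarrow> \<phi> (\<Union>AA) x = 1))"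

(* The index type of vectors carries no order; the index i plays the role of the first one. *)
definition coord_hyp :: "(real ^ 'n) set \<Rightarrow> 'n \<Rightarrow> real set \<Rightarrow> (real ^ 'n) set" where
  "coord_hyp \<Theta> i A = {\<theta> \<in> \<Theta>. \<theta> $ i \<in> A}"

end

theory Submission
  imports Defs
begin

text \<open>
  An error of the test based on \<open>R\<close>, rejecting a hypothesis containing \<open>\<theta>\<close> or accepting one
  that misses \<open>\<theta>\<close>, forces \<open>\<theta> \<notin> R(X)\<close>, which has probability at most \<open>1\<close> minus the confidence
  of \<open>R\<close>. Coherence is set algebra for subsets of a nonempty set \<open>R(x)\<close>.
\<close>

lemma outer_prob_le_measure:
  assumes "finite_measure M" "A \<subseteq> B" "B \<in> sets M"
  shows "outer_prob M A \<le> measure M B"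
proof -
  interpret finite_measure M by fact
  have "outer_measure_of M A \<le> emeasure M B"
    unfolding outer_measure_of_def using assms(2,3) by (intro INF_lower) auto
  then show ?thesis
    \<comment> \<open>Finiteness matters here: \<open>enn2real\<close> sends infinity to 0, so it is
      monotone only below a finite bound.\<close>
    unfolding outer_prob_def measure_def by (intro enn2real_mono) (auto simp: less_top[symmetric])
qed

text \<open>\<open>B\<close> will be the coverage event of a region estimator and \<open>A\<close>
  an error event. Coverage events may fail to be measurable, hence the case split.\<close>

lemma outer_prob_disjoint_le:
  assumes "prob_space M" "A \<subseteq> space M - B" "measure M B \<ge> 1 - \<gamma>"
  shows "outer_prob M A \<le> \<gamma>"
proof -
  interpret prob_space M by fact
  show ?thesis
  proof (cases "B \<in> sets M")
    case True
    then have "outer_prob M A \<le> measure M (space M - B)"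
      using assms(2) by (intro outer_prob_le_measure finite_measure_axioms) auto
    then show ?thesis
      using True assms(3) prob_compl[of B] by linarith
  next
    case False
    \<comment> \<open>The measure of \<open>B\<close> is then the junk value \<open>0\<close>, so \<open>\<gamma>\<close> is at least \<open>1\<close>.\<close>
    then have "1 \<le> \<gamma>"
      using assms(3) by (simp add: measure_notin_sets)
    moreover have "outer_prob M A \<le> measure M (space M)"
      using assms(2) by (intro outer_prob_le_measure finite_measure_axioms) auto
    ultimately show ?thesis
      by (simp add: prob_space)
  qed
qed

lemma logically_coherent_region_test:
  assumes "region_estimator X \<Theta> R" "\<And>x. x \<in> X \<Longrightarrow> R x \<noteq> {}"
  shows "logically_coherent X \<Theta> HH (region_test \<Theta> R)"
  unfolding logically_coherent_def
proof (intro ballI conjI allI impI)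
  fix x assume "x \<in> X"
  then have sub: "R x \<subseteq> \<Theta>" and ne: "R x \<noteq> {}"
    using assms by (auto simp: region_estimator_def)
  show "region_test \<Theta> R B x \<le> region_test \<Theta> R A x" if "A \<subseteq> B" for A B
    using that unfolding region_test_def by auto
  show "region_test \<Theta> R (\<Theta> - A) x = 1 - region_test \<Theta> R A x" for A
  proof -
    \<comment> \<open>Complementing \<open>A\<close> swaps the first two branches of
      \<open>region_test\<close>. Their order is harmless because a nonempty \<open>R x\<close>
      satisfies at most one of the conditions.\<close>
    have "R x \<subseteq> \<Theta> - (\<Theta> - A) \<longleftrightarrow> R x \<subseteq> A" "\<not> (R x \<subseteq> A \<and> R x \<subseteq> \<Theta> - A)"
      using sub ne by blast+
    then show ?thesis
      unfolding region_test_def by auto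
  qed
  have zero: "region_test \<Theta> R A x = 0 \<longleftrightarrow> R x \<subseteq> A" for A
    by (auto simp: region_test_def)
  \<comment> \<open>An empty \<open>R x\<close> would satisfy the right-hand side but take the value
    0, since that branch comes first.\<close>
  have one: "region_test \<Theta> R A x = 1 \<longleftrightarrow> R x \<subseteq> \<Theta> - A" for A
    using ne by (auto simp: region_test_def)
  \<comment> \<open>For empty \<open>AA\<close> this and the next claim reduce to
    \<open>sub\<close>.\<close>
  show "region_test \<Theta> R (\<Theta> \<inter> \<Inter>AA) x = 0" if "\<forall>A\<in>AA. region_test \<Theta> R A x = 0" for AA
    using that sub unfolding zero by blast
  show "region_test \<Theta> R (\<Union>AA) x = 1" if "\<forall>A\<in>AA. region_test \<Theta> R A x = 1" for AA
    using that sub unfolding one by blast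
qed

lemma has_size_region_test:
  assumes model: "statistical_model M \<Theta> P"
    and conf: "has_confidence (space M) \<Theta> P R (1 - \<gamma>)"
    and "H \<subseteq> \<Theta>"
  shows "has_size (space M) \<Theta> P H (region_test \<Theta> R H) \<gamma> \<gamma>"
proof -
  \<comment> \<open>One bound serves both errors: \<open>A\<close> is the rejection event when
    \<theta> lies in \<open>H\<close> and the acceptance event otherwise.\<close>
  have bound: "outer_prob (P \<theta>) A \<le> \<gamma>"
    if "\<theta> \<in> \<Theta>" "A \<subseteq> space M - {x \<in> space M. \<theta> \<in> R x}" for \<theta> A
  proof (rule outer_prob_disjoint_le)
    show "prob_space (P \<theta>)"
      using model that(1) by (simp add: statistical_model_def)
    have "space (P \<theta>) = space M"
      using model that(1) by (intro sets_eq_imp_space_eq) (simp add: statistical_model_def)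
    with that(2) show "A \<subseteq> space (P \<theta>) - {x \<in> space M. \<theta> \<in> R x}"
      by simp
    show "measure (P \<theta>) {x \<in> space M. \<theta> \<in> R x} \<ge> 1 - \<gamma>"
      using conf that(1) by (simp add: has_confidence_def)
  qed
  show ?thesis
    unfolding has_size_def using \<open>H \<subseteq> \<Theta>\<close>
    by (intro conjI SUP_least)
      (auto intro!: bound simp: region_test_def split: if_splits)
qed

theorem mainTheorem7:
  fixes M :: "'x measure"
    and \<Theta> :: "(real ^ 'n) set"
    and first :: 'n
    and P :: "real ^ 'n \<Rightarrow> 'x measure"
    and \<phi> :: "real \<Rightarrow> 'x \<Rightarrow> real"
    and R :: "'x \<Rightarrow> (real ^ 'n) set"
    and \<alpha> :: real
  assumes model: "statistical_model M \<Theta> P"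
    and tests: "\<And>t. agnostic_test (space M) (\<phi> t)"
    and a: "\<And>x t1 t2. x \<in> space M \<Longrightarrow> t1 \<le> t2 \<Longrightarrow> \<phi> t1 x = 0 \<Longrightarrow> \<phi> t2 x = 0"
    and b: "\<And>x t1 t2. x \<in> space M \<Longrightarrow> t1 \<le> t2 \<Longrightarrow> \<phi> t2 x = 1 \<Longrightarrow> \<phi> t1 x = 1"
    and c: "\<And>t \<theta>. \<theta> \<in> \<Theta> \<Longrightarrow> \<theta> $ first = t \<Longrightarrow>
              measure (P \<theta>) {x \<in> space M. \<phi> t x = 1/2} \<ge> 1 - 2 * \<alpha>"
    and R: "region_estimator (space M) \<Theta> R"
    and conf: "has_confidence (space M) \<Theta> P R (1 - 2 * \<alpha>)"
    and based: "\<And>t. based_on (space M) \<Theta> R (coord_hyp \<Theta> first {..t}) (\<phi> t)"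
  shows "logically_coherent (space M) \<Theta> (range (coord_hyp \<Theta> first)) (region_test \<Theta> R) \<and>
    (\<forall>\<Theta>0. has_size (space M) \<Theta> P (coord_hyp \<Theta> first \<Theta>0)
             (region_test \<Theta> R (coord_hyp \<Theta> first \<Theta>0)) (2 * \<alpha>) (2 * \<alpha>)) \<and>
    (\<forall>t. \<forall>x\<in>space M. region_test \<Theta> R (coord_hyp \<Theta> first {..t}) x = \<phi> t x)"
proof (intro conjI allI ballI)
  \<comment> \<open>Being based on \<open>R\<close> at a single threshold already makes
    \<open>R x\<close> nonempty, which coherence then uses for all hypotheses.\<close>
  have based': "R x \<noteq> {} \<and> \<phi> t x = region_test \<Theta> R (coord_hyp \<Theta> first {..t}) x"
    if "x \<in> space M" for t x
    using based that unfolding based_on_iff_region_test by blast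
  show "logically_coherent (space M) \<Theta> (range (coord_hyp \<Theta> first)) (region_test \<Theta> R)"
    using R based' by (intro logically_coherent_region_test) auto
  show "has_size (space M) \<Theta> P (coord_hyp \<Theta> first \<Theta>0)
          (region_test \<Theta> R (coord_hyp \<Theta> first \<Theta>0)) (2 * \<alpha>) (2 * \<alpha>)" for \<Theta>0
    using model conf by (rule has_size_region_test) (auto simp: coord_hyp_def)
  show "region_test \<Theta> R (coord_hyp \<Theta> first {..t}) x = \<phi> t x" if "x \<in> space M" for t x
    using based' that by simp
qed

end
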